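(* Let $G$ be a finite group, and let $a^G$ and $b^G$ be conjugacy classes of $G$ (with $a,b\in G$) such that ${\bf C}_G(a)={\bf C}_G(b)$ and $|a^G|=2$. Then $\eta(a^G b^G)=2$. In particular, $\eta(a^G a^G)=2$.
   Context: For $a,g\in G$: $a^g=g^{-1}ag$; $a^G=\{a^g\mid g\in G\}$ is the conjugacy class of $a$ in $G$; ${\bf C}_G(a)=\{g\in G\mid a^g=a\}$ is the centralizer of $a$ in $G$. For subsets $X,Y$ of $G$, $XY=\{xy\mid x\in X,\ y\in Y\}$. If $X$ is a nonempty $G$-invariant subset of $G$ (i.e. $X^g=\{x^g\mid x\in X\}=X$ for all $g\in G$), then $X$ is a union of $n$ distinct conjugacy classes of $G$ for some integer $n>0$, and one sets $\eta(X)=n$. *)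

theory Defs
  imports "HOL-Algebra.Coset"
begin

text \<open>Conjugation is the right action \<open>a\<^sup>g = g\<^sup>-\<^sup>1 a g\<close>, in contrast to the left action
  \<open>g a g\<^sup>-\<^sup>1\<close> used in HOL-Algebra. The product of subsets is the library's \<open><#>\<close>.\<close>

definition conj_elt :: "('a, 'm) monoid_scheme \<Rightarrow> 'a \<Rightarrow> 'a \<Rightarrow> 'a"
  where "conj_elt G a g = inv\<^bsub>G\<^esub> g \<otimes>\<^bsub>G\<^esub> a \<otimes>\<^bsub>G\<^esub> g"

definition conj_class :: "('a, 'm) monoid_scheme \<Rightarrow> 'a \<Rightarrow> 'a set"
  where "conj_class G a = {conj_elt G a g | g. g \<in> carrier G}"

definition conj_classes :: "('a, 'm) monoid_scheme \<Rightarrow> 'a set set"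
  where "conj_classes G = {conj_class G a | a. a \<in> carrier G}"

definition centralizer :: "('a, 'm) monoid_scheme \<Rightarrow> 'a \<Rightarrow> 'a set"
  where "centralizer G a = {g \<in> carrier G. conj_elt G a g = a}"

definition conj_invariant :: "('a, 'm) monoid_scheme \<Rightarrow> 'a set \<Rightarrow> bool"
  where "conj_invariant G X \<longleftrightarrow>
    X \<subseteq> carrier G \<and> (\<forall>g \<in> carrier G. {conj_elt G x g | x. x \<in> X} = X)"

text \<open>\<open>eta G X\<close> is the number of distinct conjugacy classes whose union is \<open>X\<close>. It is
  meaningful for nonempty invariant \<open>X\<close> in a finite group, where existence, uniqueness and positivity of this
  number are shown below; it is unspecified if \<open>X\<close> is not a finite union of classes.\<close>

definition eta :: "('a, 'm) monoid_scheme \<Rightarrow> 'a set \<Rightarrow> nat"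
  where "eta G X = (THE n. \<exists>\<C>. \<C> \<subseteq> conj_classes G \<and> finite \<C> \<and> \<Union>\<C> = X \<and> card \<C> = n)"

context group
begin

lemma conj_elt_closed:
  assumes "a \<in> carrier G" "g \<in> carrier G"
  shows "conj_elt G a g \<in> carrier G"
  using assms by (simp add: conj_elt_def)

lemma conj_elt_one:
  assumes "a \<in> carrier G"
  shows "conj_elt G a \<one> = a"
  using assms by (simp add: conj_elt_def)

lemma conj_elt_mult:
  assumes "a \<in> carrier G" "g \<in> carrier G" "h \<in> carrier G"
  shows "conj_elt G (conj_elt G a g) h = conj_elt G a (g \<otimes> h)"
  using assms by (simp add: conj_elt_def inv_mult_group m_assoc)

lemma conj_class_self:
  assumes "a \<in> carrier G"
  shows "a \<in> conj_class G a"
  unfolding conj_class_def using conj_elt_one[OF assms] by force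

lemma conj_class_eq:
  assumes "a \<in> carrier G" "x \<in> conj_class G a"
  shows "conj_class G x = conj_class G a"
proof -
  obtain g where g: "g \<in> carrier G" "x = conj_elt G a g"
    using assms(2) by (auto simp: conj_class_def)
  have sub: "conj_class G (conj_elt G c k) \<subseteq> conj_class G c"
    if "c \<in> carrier G" "k \<in> carrier G" for c k
    using that by (auto simp: conj_class_def conj_elt_mult)
  have "conj_elt G x (inv g) = a"
    using g assms(1) by (simp add: conj_elt_mult conj_elt_one)
  then show ?thesis
    using sub[OF assms(1) g(1)] sub[of x "inv g"] g conj_elt_closed[OF assms(1) g(1)] by auto
qed

lemma conj_classes_disjoint:
  assumes "K \<in> conj_classes G" "L \<in> conj_classes G" "x \<in> K" "x \<in> L"
  shows "K = L"
proof -
  obtain a b where "a \<in> carrier G" "K = conj_class G a" "b \<in> carrier G" "L = conj_class G b"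
    using assms(1,2) unfolding conj_classes_def by blast
  then show ?thesis using assms(3,4) conj_class_eq[of a x] conj_class_eq[of b x] by simp
qed

lemma eta_eq_card:
  assumes "\<C> \<subseteq> conj_classes G" "finite \<C>" "\<Union>\<C> = X"
  shows "eta G X = card \<C>"
proof -
  have sub: "\<A> \<subseteq> \<B>"
    if AB: "\<A> \<subseteq> conj_classes G" "\<B> \<subseteq> conj_classes G" "\<Union>\<A> = \<Union>\<B>" for \<A> \<B>
  proof
    fix K assume K: "K \<in> \<A>"
    then obtain a where a: "a \<in> carrier G" "K = conj_class G a"
      using AB(1) by (auto simp: conj_classes_def)
    then have aK: "a \<in> K" using conj_class_self by simp
    then obtain L where "L \<in> \<B>" "a \<in> L" using K AB(3) by blast
    then show "K \<in> \<B>" using conj_classes_disjoint[OF _ _ aK, of L] K AB(1,2) by blast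
  qed
  have "\<D> = \<C>" if "\<D> \<subseteq> conj_classes G" "\<Union>\<D> = X" for \<D>
    using sub[of \<D> \<C>] sub[of \<C> \<D>] that assms by (intro equalityI) simp_all
  then show ?thesis
    unfolding eta_def using assms by (intro the_equality) blast+
qed

lemma conj_invariant_imp_union_of_classes:
  assumes "finite (carrier G)" "conj_invariant G X" "X \<noteq> {}"
  shows "\<exists>\<C>. \<C> \<subseteq> conj_classes G \<and> finite \<C> \<and> \<Union>\<C> = X \<and> card \<C> = eta G X \<and> eta G X > 0"
proof -
  let ?C = "conj_class G ` X"
  have X: "X \<subseteq> carrier G" "finite X"
    using assms finite_subset by (auto simp: conj_invariant_def)
  have "conj_class G x \<subseteq> X" if "x \<in> X" for x
    using assms(2) that unfolding conj_class_def conj_invariant_def by blast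
  moreover have "x \<in> conj_class G x" if "x \<in> X" for x
    using that X conj_class_self by blast
  ultimately have "\<Union>?C = X" by blast
  moreover have "?C \<subseteq> conj_classes G" using X by (auto simp: conj_classes_def)
  ultimately show ?thesis
    using eta_eq_card[of ?C X] X assms(3) by (intro exI[of _ ?C]) (auto simp: card_gt_0_iff)
qed

end

end

theory Submission
  imports Defs
begin

text \<open>The element \<open>a\<^sup>g\<close> depends only on the right coset of \<open>g\<close> modulo the centralizer of \<open>a\<close>. If \<open>a\<close> and
  \<open>b\<close> have the same centralizer, then \<open>a\<^sup>g \<mapsto> b\<^sup>g\<close> is therefore a well-defined bijection from the class
  of \<open>a\<close> to that of \<open>b\<close> (\<open>conj_elt_eq_transfer\<close>). So if the first class is \<open>{a, a'}\<close>, the second is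
  a two-element set \<open>{b, b'}\<close>, and every \<open>g\<close> either fixes all four elements or swaps both
  \<open>a\<close> with \<open>a'\<close> and \<open>b\<close> with \<open>b'\<close> (\<open>simultaneous_swap\<close>).

  Hence among the four products \<open>ab\<close>, \<open>a'b'\<close>, \<open>ab'\<close>, \<open>a'b\<close> the conjugacy classes are \<open>{ab, a'b'}\<close> and
  \<open>{ab', a'b}\<close>. These are different, because cancellation keeps \<open>ab\<close> away from \<open>ab'\<close> and
  from \<open>a'b\<close>, although either class may be a singleton. The second assertion is the case \<open>b = a\<close>.\<close>

context group
begin

lemma conj_elt_distrib:
  assumes "x \<in> carrier G" "y \<in> carrier G" "g \<in> carrier G"
  shows "conj_elt G (x \<otimes> y) g = conj_elt G x g \<otimes> conj_elt G y g"
proof -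
  have "g \<otimes> (inv g \<otimes> (y \<otimes> g)) = y \<otimes> g"
    using assms by (simp flip: m_assoc)
  then show ?thesis
    using assms by (simp add: conj_elt_def m_assoc)
qed

lemma conj_elt_cancel:
  assumes "x \<in> carrier G" "y \<in> carrier G" "g \<in> carrier G"
  shows "conj_elt G x g = conj_elt G y g \<longleftrightarrow> x = y"
  using assms by (simp add: conj_elt_def)

lemma conj_elt_eq_iff_centralizer:
  assumes "a \<in> carrier G" "g \<in> carrier G" "h \<in> carrier G"
  shows "conj_elt G a g = conj_elt G a h \<longleftrightarrow> g \<otimes> inv h \<in> centralizer G a"
proof -
  have "conj_elt G a g = conj_elt G (conj_elt G a (g \<otimes> inv h)) h"
    using assms by (simp add: conj_elt_mult m_assoc)
  then show ?thesis
    using assms by (simp add: conj_elt_cancel conj_elt_closed centralizer_def)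
qed

lemma conj_elt_eq_transfer:
  assumes "a \<in> carrier G" "b \<in> carrier G" "centralizer G a = centralizer G b"
    and "g \<in> carrier G" "h \<in> carrier G"
  shows "conj_elt G a g = conj_elt G a h \<longleftrightarrow> conj_elt G b g = conj_elt G b h"
  using assms by (simp add: conj_elt_eq_iff_centralizer)

lemma conj_class_two_elements:
  assumes "a \<in> carrier G" "card (conj_class G a) = 2"
  obtains t where "t \<in> carrier G" "conj_elt G a t \<noteq> a" "conj_class G a = {a, conj_elt G a t}"
proof -
  obtain x y where "conj_class G a = {x, y}" "x \<noteq> y"
    using assms(2) by (auto simp: card_2_iff)
  then have "\<exists>c. conj_class G a = {a, c} \<and> c \<noteq> a"
    using conj_class_self[OF assms(1)] by (metis insertE insert_commute singletonD)
  then obtain c where c: "conj_class G a = {a, c}" "c \<noteq> a"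
    by blast
  then obtain t where "t \<in> carrier G" "c = conj_elt G a t"
    unfolding conj_class_def by blast
  with c that show ?thesis by blast
qed

text \<open>By the transfer of equalities between the two classes, \<open>a\<^sup>g\<close> determines \<open>b\<^sup>g\<close>. The images of
  \<open>a\<^sup>t\<close> and \<open>b\<^sup>t\<close> then follow because conjugation by \<open>g\<close> permutes each two-element class.\<close>

lemma simultaneous_swap:
  assumes a: "a \<in> carrier G" and b: "b \<in> carrier G"
    and cent: "centralizer G a = centralizer G b"
    and t: "t \<in> carrier G" "conj_elt G a t \<noteq> a" "conj_class G a = {a, conj_elt G a t}"
    and g: "g \<in> carrier G"
  defines "a' \<equiv> conj_elt G a t" and "b' \<equiv> conj_elt G b t"
  shows "conj_elt G a g = a \<and> conj_elt G a' g = a' \<and> conj_elt G b g = b \<and> conj_elt G b' g = b'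
       \<or> conj_elt G a g = a' \<and> conj_elt G a' g = a \<and> conj_elt G b g = b' \<and> conj_elt G b' g = b"
proof -
  note transfer = conj_elt_eq_transfer[OF a b cent]
  have dichotomy: "conj_elt G a h = a \<and> conj_elt G b h = b \<or> conj_elt G a h = a' \<and> conj_elt G b h = b'"
    if h: "h \<in> carrier G" for h
  proof -
    have "conj_elt G a h \<in> {a, a'}"
      using t(3) h unfolding a'_def conj_class_def by blast
    then show ?thesis
      using transfer[OF h one_closed] transfer[OF h t(1)] a b
      by (auto simp: conj_elt_one a'_def b'_def)
  qed
  have closed: "a' \<in> carrier G" "b' \<in> carrier G"
    using a b t(1) by (simp_all add: a'_def b'_def conj_elt_closed)
  have "a' \<noteq> a" "b' \<noteq> b"
    using t(2) transfer[OF t(1) one_closed] a b by (auto simp: a'_def b'_def conj_elt_one)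
  then have moved: "conj_elt G a' g \<noteq> conj_elt G a g" "conj_elt G b' g \<noteq> conj_elt G b g"
    using a b g closed by (simp_all add: conj_elt_cancel)
  have "conj_elt G a' g = conj_elt G a (t \<otimes> g)" "conj_elt G b' g = conj_elt G b (t \<otimes> g)"
    using a b t(1) g by (simp_all add: a'_def b'_def conj_elt_mult)
  then show ?thesis
    using dichotomy[OF g] dichotomy[of "t \<otimes> g"] t(1) g moved by auto
qed

lemma eta_product_of_two_element_classes:
  assumes a: "a \<in> carrier G" and b: "b \<in> carrier G"
    and cent: "centralizer G a = centralizer G b"
    and card: "card (conj_class G a) = 2"
  shows "eta G (conj_class G a <#> conj_class G b) = 2"
proof -
  obtain t where t: "t \<in> carrier G" "conj_elt G a t \<noteq> a" "conj_class G a = {a, conj_elt G a t}"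
    using conj_class_two_elements[OF a card] by blast
  define a' b' where "a' = conj_elt G a t" and "b' = conj_elt G b t"
  have closed: "a' \<in> carrier G" "b' \<in> carrier G"
    using a b t(1) by (simp_all add: a'_def b'_def conj_elt_closed)
  have ne: "a' \<noteq> a" "b' \<noteq> b"
    using t(2) conj_elt_eq_transfer[OF a b cent t(1) one_closed] a b
    by (auto simp: a'_def b'_def conj_elt_one)
  note swap = simultaneous_swap[OF a b cent t, folded a'_def b'_def]
  have at_t: "conj_elt G a t = a'" "conj_elt G a' t = a" "conj_elt G b t = b'" "conj_elt G b' t = b"
    using swap[OF t(1)] ne by (auto simp: a'_def b'_def)
  have class_pair: "conj_class G x = {x, y}"
    if "x \<in> carrier G" "conj_elt G x t = y"
      and "\<And>g. g \<in> carrier G \<Longrightarrow> conj_elt G x g \<in> {x, y}" for x y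
    using that conj_class_self[of x] t(1) unfolding conj_class_def by blast
  have class_b: "conj_class G b = {b, b'}"
    using b swap by (intro class_pair) (auto simp: at_t)
  have class_ab: "conj_class G (a \<otimes> b) = {a \<otimes> b, a' \<otimes> b'}"
  proof (rule class_pair)
    show "conj_elt G (a \<otimes> b) g \<in> {a \<otimes> b, a' \<otimes> b'}" if "g \<in> carrier G" for g
      using swap[OF that] a b that by (auto simp: conj_elt_distrib)
  qed (use a b t(1) in \<open>simp_all add: conj_elt_distrib at_t\<close>)
  have class_ab': "conj_class G (a \<otimes> b') = {a \<otimes> b', a' \<otimes> b}"
  proof (rule class_pair)
    show "conj_elt G (a \<otimes> b') g \<in> {a \<otimes> b', a' \<otimes> b}" if "g \<in> carrier G" for g
      using swap[OF that] a closed that by (auto simp: conj_elt_distrib)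
  qed (use a closed t(1) in \<open>simp_all add: conj_elt_distrib at_t\<close>)
  have "a \<otimes> b \<notin> conj_class G (a \<otimes> b')"
    using a b closed ne by (auto simp: class_ab')
  then have distinct: "conj_class G (a \<otimes> b) \<noteq> conj_class G (a \<otimes> b')"
    using conj_class_self[of "a \<otimes> b"] a b by auto
  have "conj_class G a <#> conj_class G b = \<Union>{conj_class G (a \<otimes> b), conj_class G (a \<otimes> b')}"
    using t(3) by (auto simp: set_mult_def class_b class_ab class_ab' a'_def[symmetric])
  moreover have "{conj_class G (a \<otimes> b), conj_class G (a \<otimes> b')} \<subseteq> conj_classes G"
    using a b closed unfolding conj_classes_def by blast
  ultimately have "eta G (conj_class G a <#> conj_class G b)
      = card {conj_class G (a \<otimes> b), conj_class G (a \<otimes> b')}"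
    by (intro eta_eq_card) auto
  then show ?thesis
    using distinct by simp
qed

end

theorem proposition3p4:
  fixes G :: "('a, 'm) monoid_scheme" and a b :: 'a
  assumes "group G" and "finite (carrier G)"
    and "a \<in> carrier G" and "b \<in> carrier G"
    and "centralizer G a = centralizer G b"
    and "card (conj_class G a) = 2"
  shows "eta G (conj_class G a <#>\<^bsub>G\<^esub> conj_class G b) = 2
       \<and> eta G (conj_class G a <#>\<^bsub>G\<^esub> conj_class G a) = 2"
proof -
  interpret group G by fact
  show ?thesis
    using assms eta_product_of_two_element_classes by simp
qed

end
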